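(* Let $H$ be any connected $K_4$-free graph on $5$ vertices that contains $K_3$ as a subgraph. If $H$ is isomorphic neither to $W_5 = K_1 + C_4$ nor to $\overline{P_2 \cup P_3}$, then the edge Folkman number $F_e(K_3,K_3;H)$ does not exist.
   Context: All graphs are finite, undirected and simple. $P_n$ is the path on $n$ vertices, $C_n$ the cycle on $n$ vertices, $\overline{G}$ the complement of $G$, $\cup$ disjoint union, and $K_1+C_4$ the join (a vertex adjacent to all vertices of a $4$-cycle). A graph is $H$-free if it contains no subgraph isomorphic to $H$. $F_e(K_3,K_3;H)$ is the smallest $n$ such that some $H$-free graph on $n$ vertices has every red-blue edge coloring containing a monochromatic $K_3$; it "exists" if such a graph exists. *)

theory Defs
  imports "HOL-Library.Ramsey"
begin

text \<open>
  Undirected edges are two-element vertex sets; \<open>[A]\<^bsup>2\<^esup>\<close> is the library's set of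
  two-element subsets of \<open>A\<close> (constant \<^const>\<open>nsets\<close>).
\<close>

datatype 'a ugraph = UGraph (verts: "'a set") (edges: "'a set set")

definition simple_graph :: "'a ugraph \<Rightarrow> bool" where
  "simple_graph G \<longleftrightarrow> finite (verts G) \<and> edges G \<subseteq> [verts G]\<^bsup>2\<^esup>"

definition adjacent :: "'a ugraph \<Rightarrow> 'a \<Rightarrow> 'a \<Rightarrow> bool" where
  "adjacent G u v \<longleftrightarrow> {u, v} \<in> edges G"

definition connected_graph :: "'a ugraph \<Rightarrow> bool" where
  "connected_graph G \<longleftrightarrow>
     verts G \<noteq> {} \<and> (\<forall>u\<in>verts G. \<forall>v\<in>verts G. (adjacent G)\<^sup>*\<^sup>* u v)"

definition subgraph :: "'a ugraph \<Rightarrow> 'a ugraph \<Rightarrow> bool" where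
  "subgraph F G \<longleftrightarrow> simple_graph F \<and> verts F \<subseteq> verts G \<and> edges F \<subseteq> edges G"

definition isomorphic :: "'a ugraph \<Rightarrow> 'b ugraph \<Rightarrow> bool" where
  "isomorphic G H \<longleftrightarrow> (\<exists>f. bij_betw f (verts G) (verts H) \<and>
     (\<forall>u\<in>verts G. \<forall>v\<in>verts G. adjacent G u v \<longleftrightarrow> adjacent H (f u) (f v)))"

text \<open>Subgraphs are not required to be induced.\<close>

definition contains_graph :: "'a ugraph \<Rightarrow> 'b ugraph \<Rightarrow> bool" where
  "contains_graph G H \<longleftrightarrow> (\<exists>F. subgraph F G \<and> isomorphic F H)"

abbreviation free_of :: "'a ugraph \<Rightarrow> 'b ugraph \<Rightarrow> bool" where
  "free_of G H \<equiv> \<not> contains_graph G H"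

definition complete_graph :: "nat \<Rightarrow> nat ugraph" where
  "complete_graph n = UGraph {..<n} ([{..<n}]\<^bsup>2\<^esup>)"

definition path_graph :: "nat \<Rightarrow> nat ugraph" where
  "path_graph n = UGraph {..<n} {{i, Suc i} | i. Suc i < n}"

text \<open>A cycle only for \<open>n \<ge> 3\<close>.\<close>

definition cycle_graph :: "nat \<Rightarrow> nat ugraph" where
  "cycle_graph n = UGraph {..<n} {{i, Suc i mod n} | i. i < n}"

definition complement_graph :: "'a ugraph \<Rightarrow> 'a ugraph" where
  "complement_graph G = UGraph (verts G) ([verts G]\<^bsup>2\<^esup> - edges G)"

definition disjoint_union :: "'a ugraph \<Rightarrow> 'b ugraph \<Rightarrow> ('a + 'b) ugraph" where
  "disjoint_union G H =
     UGraph (verts G <+> verts H) ((`) Inl ` edges G \<union> (`) Inr ` edges H)"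

definition join_graph :: "'a ugraph \<Rightarrow> 'b ugraph \<Rightarrow> ('a + 'b) ugraph" where
  "join_graph G H = UGraph (verts G <+> verts H)
     (edges (disjoint_union G H) \<union> {{Inl u, Inr v} | u v. u \<in> verts G \<and> v \<in> verts H})"

datatype colour = Red | Blue

definition colour_class :: "'a ugraph \<Rightarrow> ('a set \<Rightarrow> colour) \<Rightarrow> colour \<Rightarrow> 'a ugraph" where
  "colour_class G c k = UGraph (verts G) {e \<in> edges G. c e = k}"

definition edge_arrows :: "'a ugraph \<Rightarrow> 'b ugraph \<Rightarrow> 'c ugraph \<Rightarrow> bool" where
  "edge_arrows G A B \<longleftrightarrow> (\<forall>c. contains_graph (colour_class G c Red) A \<or>
                                  contains_graph (colour_class G c Blue) B)"

text \<open>
  It suffices to let the vertices of the host graph range over \<open>nat\<close>; see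
  \<open>edge_folkman_existsI\<close> below.
\<close>

definition edge_folkman_orders :: "'b ugraph \<Rightarrow> 'c ugraph \<Rightarrow> 'd ugraph \<Rightarrow> nat set" where
  "edge_folkman_orders A B H = {n. \<exists>G :: nat ugraph.
     simple_graph G \<and> card (verts G) = n \<and> free_of G H \<and> edge_arrows G A B}"

definition edge_folkman_number :: "'b ugraph \<Rightarrow> 'c ugraph \<Rightarrow> 'd ugraph \<Rightarrow> nat" where
  "edge_folkman_number A B H = (LEAST n. n \<in> edge_folkman_orders A B H)"

definition edge_folkman_exists :: "'b ugraph \<Rightarrow> 'c ugraph \<Rightarrow> 'd ugraph \<Rightarrow> bool" where
  "edge_folkman_exists A B H \<longleftrightarrow> edge_folkman_orders A B H \<noteq> {}"

definition image_graph :: "('a \<Rightarrow> 'b) \<Rightarrow> 'a ugraph \<Rightarrow> 'b ugraph" where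
  "image_graph f G = UGraph (f ` verts G) ((`) f ` edges G)"

lemma simple_graph_image_graph:
  assumes "simple_graph G" "inj_on f (verts G)"
  shows "simple_graph (image_graph f G)"
proof -
  have "f ` e \<in> [f ` verts G]\<^bsup>2\<^esup>" if "e \<in> edges G" for e
  proof -
    have e: "e \<subseteq> verts G" "finite e" "card e = 2"
      using that assms(1) by (auto simp: simple_graph_def nsets_def)
    moreover have "card (f ` e) = card e"
      using e assms(2) by (meson card_image inj_on_subset)
    ultimately show ?thesis by (auto simp: nsets_def)
  qed
  then show ?thesis
    using assms(1) by (auto simp: simple_graph_def image_graph_def)
qed

lemma contains_graph_image_graph:
  assumes inj: "inj_on f (verts G)" and G: "simple_graph G" and "contains_graph G H"
  shows "contains_graph (image_graph f G) H"
proof -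
  obtain F h where F: "subgraph F G" and h: "bij_betw h (verts F) (verts H)"
    and adj: "\<And>u v. u \<in> verts F \<Longrightarrow> v \<in> verts F \<Longrightarrow> adjacent F u v \<longleftrightarrow> adjacent H (h u) (h v)"
    using assms(3) unfolding contains_graph_def isomorphic_def by blast
  have sF: "simple_graph F" and VF: "verts F \<subseteq> verts G" and EF: "edges F \<subseteq> edges G"
    using F by (auto simp: subgraph_def)
  have injF: "inj_on f (verts F)" using inj VF by (meson inj_on_subset)
  let ?g = "the_inv_into (verts F) f"
  have g: "bij_betw ?g (f ` verts F) (verts F)"
    using injF by (simp add: bij_betw_the_inv_into inj_on_imp_bij_betw)
  have gf: "?g (f u) = u" if "u \<in> verts F" for u
    using injF that by (simp add: the_inv_into_f_f)
  have adjf: "adjacent (image_graph f F) (f u) (f v) \<longleftrightarrow> adjacent F u v"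
    if "u \<in> verts F" "v \<in> verts F" for u v
  proof
    assume "adjacent (image_graph f F) (f u) (f v)"
    then obtain e where e: "e \<in> edges F" "f ` e = f ` {u, v}"
      by (auto simp: adjacent_def image_graph_def)
    moreover have "e \<subseteq> verts F" using e(1) sF by (auto simp: simple_graph_def nsets_def)
    ultimately have "e = {u, v}"
      using inj_on_image_eq_iff[OF injF, of e "{u, v}"] that by simp
    then show "adjacent F u v" using e(1) by (simp add: adjacent_def)
  next
    assume "adjacent F u v"
    then have "f ` {u, v} \<in> (`) f ` edges F" unfolding adjacent_def by blast
    then show "adjacent (image_graph f F) (f u) (f v)"
      by (simp add: adjacent_def image_graph_def)
  qed
  have "subgraph (image_graph f F) (image_graph f G)"
    using simple_graph_image_graph[OF sF injF] VF EF
    by (auto simp: subgraph_def image_graph_def)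
  moreover have "isomorphic (image_graph f F) H"
    unfolding isomorphic_def
  proof (intro exI conjI ballI)
    show "bij_betw (h \<circ> ?g) (verts (image_graph f F)) (verts H)"
      using bij_betw_trans[OF g h] by (simp add: image_graph_def)
  next
    fix x y assume "x \<in> verts (image_graph f F)" "y \<in> verts (image_graph f F)"
    then obtain u v where "x = f u" "y = f v" "u \<in> verts F" "v \<in> verts F"
      by (auto simp: image_graph_def)
    then show "adjacent (image_graph f F) x y \<longleftrightarrow> adjacent H ((h \<circ> ?g) x) ((h \<circ> ?g) y)"
      using adjf adj gf by simp
  qed
  ultimately show ?thesis unfolding contains_graph_def by blast
qed

lemma image_graph_inverse:
  assumes "simple_graph G" and gf: "\<And>v. v \<in> verts G \<Longrightarrow> g (f v) = v"
  shows "image_graph g (image_graph f G) = G"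
proof -
  have e: "g ` f ` e = e" if "e \<subseteq> verts G" for e
  proof -
    have "(\<lambda>v. g (f v)) ` e = (\<lambda>v. v) ` e"
      using that gf by (intro image_cong) auto
    then show ?thesis by (simp only: image_image image_ident)
  qed
  have "(`) g ` (`) f ` edges G = edges G"
  proof -
    have "g ` f ` e = e" if "e \<in> edges G" for e
      using that assms(1) by (intro e) (auto simp: simple_graph_def nsets_def)
    then have "(\<lambda>e. g ` f ` e) ` edges G = (\<lambda>e. e) ` edges G"
      by (rule image_cong[OF refl])
    then show ?thesis by (simp only: image_image image_ident)
  qed
  then show ?thesis
    using e[of "verts G"] by (simp add: image_graph_def ugraph.expand)
qed

lemma edge_folkman_existsI:
  fixes G :: "'a ugraph"
  assumes G: "simple_graph G" "free_of G H" "edge_arrows G A B"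
  shows "edge_folkman_exists A B H"
proof -
  obtain f :: "'a \<Rightarrow> nat" where f: "inj_on f (verts G)"
    using G(1) finite_imp_inj_to_nat_seg[of "verts G"] by (auto simp: simple_graph_def)
  define g where "g = the_inv_into (verts G) f"
  have gf: "g (f v) = v" if "v \<in> verts G" for v
    using f that by (simp add: g_def the_inv_into_f_f)
  let ?G = "image_graph f G"
  have sG: "simple_graph ?G" using G(1) f by (rule simple_graph_image_graph)
  have "inj_on g (verts ?G)"
    using gf by (auto simp: image_graph_def inj_on_def)
  then have "free_of ?G H"
    using contains_graph_image_graph[of g ?G H] sG G(2) image_graph_inverse[OF G(1), of g f] gf by auto
  moreover have "edge_arrows ?G A B"
    unfolding edge_arrows_def
  proof
    fix c :: "nat set \<Rightarrow> colour"
    have cc: "image_graph f (colour_class G (\<lambda>e. c (f ` e)) k) = colour_class ?G c k" for k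
      by (auto simp: colour_class_def image_graph_def)
    have "simple_graph (colour_class G d k)" for d k
      using G(1) by (auto simp: simple_graph_def colour_class_def)
    moreover have "inj_on f (verts (colour_class G d k))" for d k
      using f by (simp add: colour_class_def)
    ultimately show "contains_graph (colour_class ?G c Red) A \<or>
                     contains_graph (colour_class ?G c Blue) B"
      using G(3) contains_graph_image_graph[of f "colour_class G (\<lambda>e. c (f ` e)) Red" A]
        contains_graph_image_graph[of f "colour_class G (\<lambda>e. c (f ` e)) Blue" B]
      unfolding edge_arrows_def cc by blast
  qed
  ultimately show ?thesis
    using sG unfolding edge_folkman_exists_def edge_folkman_orders_def by blast
qed

end

theory Submission
  imports Defs
begin

text \<open>
  The complement of \<open>H\<close> contains a triangle or a path on four vertices: otherwise it is a forest of
  stars, by \<open>K\<^sub>4\<close>-freeness with at least two nontrivial components, so \<open>2K\<^sub>2 \<union> K\<^sub>1\<close> or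
  \<open>P\<^sub>2 \<union> P\<^sub>3\<close>, which are the two excluded cases. Hence \<open>H\<close> is a subgraph of the book
  \<open>K\<^sub>1\<^sub>,\<^sub>1\<^sub>,\<^sub>3\<close> or of the gem \<open>K\<^sub>1 + P\<^sub>4\<close>. In a book-free graph every edge lies in at most two
  triangles; in a gem-free graph every triangle either has an edge that lies in no other triangle
  or has all its edges in at most two triangles. In both cases the hypergraph whose points are the
  edges and whose hyperedges are the triangles of the graph is two-colourable.
\<close>

section \<open>Two-colouring of hypergraphs\<close>

fun opposite :: "colour \<Rightarrow> colour" where
  "opposite Red = Blue"
| "opposite Blue = Red"

lemma opposite_neq [simp]: "opposite k \<noteq> k" "k \<noteq> opposite k"
  by (cases k; simp)+

text \<open>The empty set counts as constant, so a hyperedge with no coloured element yet is also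
  subject to the invariant below.\<close>

definition constant_on :: "('e \<Rightarrow> colour) \<Rightarrow> 'e set \<Rightarrow> bool" where
  "constant_on c t \<longleftrightarrow> (\<exists>k. \<forall>e\<in>t. c e = k)"

lemma constant_on_cong: "(\<And>e. e \<in> t \<Longrightarrow> c e = d e) \<Longrightarrow> constant_on c t \<longleftrightarrow> constant_on d t"
  by (simp add: constant_on_def)

text \<open>
  The colour of every element of \<open>U\<close> is still open. All hyperedges except possibly one
  retain two open elements as long as their coloured part is monochromatic. Repairing a hyperedge
  whose coloured part is monochromatic, the exceptional one first, takes an open element from at
  most one other hyperedge, so the invariant survives.
\<close>

lemma extend_colouring:
  fixes F :: "'e set set"
  assumes "finite U"
    and "\<And>t. t \<in> F \<Longrightarrow> finite t \<and> card t \<ge> 3"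
    and deg: "\<And>e r s t. e \<in> r \<Longrightarrow> e \<in> s \<Longrightarrow> e \<in> t \<Longrightarrow> r \<in> F \<Longrightarrow> s \<in> F \<Longrightarrow> t \<in> F \<Longrightarrow> r = s \<or> s = t \<or> r = t"
    and "t0 \<in> F \<Longrightarrow> constant_on c (t0 - U) \<Longrightarrow> card (t0 \<inter> U) \<ge> 1"
    and "\<And>t. t \<in> F \<Longrightarrow> t \<noteq> t0 \<Longrightarrow> constant_on c (t - U) \<Longrightarrow> card (t \<inter> U) \<ge> 2"
  shows "\<exists>d. \<forall>t\<in>F. \<not> constant_on d t"
  using assms(1,4,5)
proof (induction "card U" arbitrary: U c t0)
  case 0
  then have "U = {}" by simp
  then have "\<forall>t\<in>F. \<not> constant_on c t"
    using 0(3,4) by fastforce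
  then show ?case by blast
next
  case (Suc n)
  have cU: "card (U - {e}) = n" "finite (U - {e})" if "e \<in> U" for e
    using Suc.hyps(2) Suc.prems(1) that by auto
  have drop: "card (t \<inter> (U - {e})) \<ge> card (t \<inter> U) - 1" for t e
  proof -
    have "t \<inter> (U - {e}) = (t \<inter> U) - {e}" by auto
    then show ?thesis using Suc.prems(1) by (simp add: card_Diff_singleton_if)
  qed
  \<comment> \<open>Closing \<open>e\<close> only enlarges the coloured part, so a hyperedge whose
    coloured part is monochromatic afterwards had this property before.\<close>
  have mono: "constant_on c (t - U)" if "constant_on (c(e := k)) (t - (U - {e}))" "e \<in> U" for t e k
    using that unfolding constant_on_def by (metis DiffE DiffI fun_upd_other)
  have same: "t \<inter> (U - {e}) = t \<inter> U" if "e \<notin> t" for t e using that by auto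
  show ?case
  proof (cases "\<exists>t\<in>F. constant_on c (t - U) \<and> t - U \<noteq> {} \<and> t \<inter> U \<noteq> {}")
    case False
    \<comment> \<open>In this case every hyperedge with monochromatic coloured part is wholly open,
      so it has three open elements and any \<open>e\<close> may be closed with its present
      colour.\<close>
    then have all: "card (t \<inter> U) \<ge> 3" if "t \<in> F" "constant_on c (t - U)" for t
    proof -
      have "t \<inter> U \<noteq> {}"
        using Suc.prems(2) Suc.prems(3)[of t] that by (cases "t = t0") auto
      then have "t - U = {}" using False that by blast
      then have "t \<inter> U = t" by blast
      then show ?thesis using assms(2) that by simp
    qed
    obtain e where e: "e \<in> U" using Suc.hyps(2) by fastforce
    have "card (t \<inter> (U - {e})) \<ge> 2"
      if "t \<in> F" "constant_on c (t - (U - {e}))" for t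
      using all[of t] drop[of t e] mono[of e "c e" t] that e by fastforce
    then show ?thesis
      using Suc.hyps(1)[of "U - {e}" t0 c] cU[OF e] by (smt (verit) one_le_numeral order_trans)
  next
    case True
    \<comment> \<open>Picking \<open>t0\<close> whenever it is monochromatic so far with a single
      open element guarantees two open elements in every other hyperedge still to be
      repaired.\<close>
    have "\<exists>t\<in>F. constant_on c (t - U) \<and> t - U \<noteq> {} \<and> t \<inter> U \<noteq> {}
        \<and> (\<forall>s\<in>F. s \<noteq> t \<longrightarrow> constant_on c (s - U) \<longrightarrow> card (s \<inter> U) \<ge> 2)"
    proof (cases "t0 \<in> F \<and> constant_on c (t0 - U) \<and> card (t0 \<inter> U) < 2")
      case True
      then have "card (t0 \<inter> U) = 1" using Suc.prems(2) by linarith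
      moreover have "t0 - U \<noteq> {}"
      proof
        assume "t0 - U = {}"
        then have "t0 \<inter> U = t0" by blast
        then show False using assms(2)[of t0] True by simp
      qed
      ultimately show ?thesis using True Suc.prems(3) by (intro bexI[of _ t0]) auto
    next
      case False
      then show ?thesis using True Suc.prems(3) by (metis not_le)
    qed
    then obtain t e where t: "t \<in> F" "constant_on c (t - U)" "t - U \<noteq> {}" "e \<in> t" "e \<in> U"
      and others: "\<And>s. s \<in> F \<Longrightarrow> s \<noteq> t \<Longrightarrow> constant_on c (s - U) \<Longrightarrow> card (s \<inter> U) \<ge> 2"
      by blast
    from t(3) obtain f where f: "f \<in> t" "f \<notin> U" by blast
    define c' where "c' = c(e := opposite (c f))"
    have "c' e \<noteq> c' f" using f t(5) by (auto simp: c'_def)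
    then have t': "\<not> constant_on c' (t - (U - {e}))"
      using f t(4) unfolding constant_on_def by (metis DiffE DiffI singletonI)
    \<comment> \<open>At most one further hyperedge contains \<open>e\<close>; it becomes the
      exceptional one, since it may drop from two open elements to one.\<close>
    obtain s0 where s0: "\<And>s. s \<in> F \<Longrightarrow> e \<in> s \<Longrightarrow> s = t \<or> s = s0"
      using deg t(1,4) by metis
    show ?thesis
    proof (rule Suc.hyps(1)[of "U - {e}" s0 c'])
      show "n = card (U - {e})" "finite (U - {e})" using cU t(5) by auto
    next
      assume "s0 \<in> F" "constant_on c' (s0 - (U - {e}))"
      then show "1 \<le> card (s0 \<inter> (U - {e}))"
        using t' others[of s0] mono[of e _ s0] drop[of s0 e] t(5) unfolding c'_def by fastforce
    next
      fix s assume s: "s \<in> F" "s \<noteq> s0" "constant_on c' (s - (U - {e}))"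
      then have "s \<noteq> t" "e \<notin> s" using t' s0 by auto
      then show "2 \<le> card (s \<inter> (U - {e}))"
        using others[of s] mono[of e _ s] same[of e s] s t(5) unfolding c'_def by auto
    qed
  qed
qed

text \<open>A hyperedge with a private element can be removed: after colouring the rest, the private
  element is free to break it. Once no private elements remain, each element lies in at most two
  hyperedges and \<open>extend_colouring\<close> applies.\<close>

lemma two_colouring:
  fixes F :: "'e set set"
  assumes "finite F"
    and "\<And>t. t \<in> F \<Longrightarrow> finite t \<and> card t \<ge> 3"
    and "\<And>t. t \<in> F \<Longrightarrow> (\<exists>e\<in>t. \<forall>s\<in>F. e \<in> s \<longrightarrow> s = t)
      \<or> (\<forall>e\<in>t. \<forall>r\<in>F. \<forall>s\<in>F. e \<in> r \<longrightarrow> e \<in> s \<longrightarrow> r = s \<or> s = t \<or> r = t)"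
  shows "\<exists>c. \<forall>t\<in>F. \<not> constant_on c t"
  using assms
proof (induction "card F" arbitrary: F)
  case 0
  then show ?case by simp
next
  case (Suc n)
  show ?case
  proof (cases "\<exists>t\<in>F. \<exists>e\<in>t. \<forall>s\<in>F. e \<in> s \<longrightarrow> s = t")
    case True
    then obtain t e where t: "t \<in> F" "e \<in> t" "\<And>s. s \<in> F \<Longrightarrow> e \<in> s \<Longrightarrow> s = t" by blast
    \<comment> \<open>Both alternatives of the hypothesis survive the deletion of a
      hyperedge.\<close>
    have "\<exists>c. \<forall>s\<in>F - {t}. \<not> constant_on c s"
    proof (rule Suc.hyps(1))
      show "n = card (F - {t})" using Suc.hyps(2) Suc.prems(1) t(1) by simp
    next
      fix s assume "s \<in> F - {t}"
      then show "(\<exists>e\<in>s. \<forall>r\<in>F - {t}. e \<in> r \<longrightarrow> r = s)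
        \<or> (\<forall>e\<in>s. \<forall>q\<in>F - {t}. \<forall>r\<in>F - {t}. e \<in> q \<longrightarrow> e \<in> r \<longrightarrow> q = r \<or> r = s \<or> q = s)"
        using Suc.prems(3)[of s] by blast
    qed (use Suc.prems in auto)
    then obtain c where c: "\<And>s. s \<in> F \<Longrightarrow> s \<noteq> t \<Longrightarrow> \<not> constant_on c s" by blast
    have "\<not> t \<subseteq> {e}" using Suc.prems(2)[OF t(1)] card_mono[of "{e}" t] by auto
    then obtain f where f: "f \<in> t" "f \<noteq> e" by blast
    define c' where "c' = c(e := opposite (c f))"
    have "c' e \<noteq> c' f" using f by (simp add: c'_def)
    then have "\<not> constant_on c' t" using t(2) f(1) unfolding constant_on_def by metis
    moreover have "\<not> constant_on c' s" if "s \<in> F" "s \<noteq> t" for s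
    proof -
      have "e \<notin> s" using t(3) that by blast
      then show ?thesis
        using c[OF that] constant_on_cong[of s c c'] unfolding c'_def by (metis fun_upd_other)
    qed
    ultimately show ?thesis by blast
  next
    case False
    show ?thesis
    \<comment> \<open>Everything is open at the start. The exceptional hyperedge \<open>{}\<close>
      is a dummy, outside \<open>F\<close> because members have at least three elements, and the
      initial colour \<open>Red\<close> is arbitrary.\<close>
    proof (rule extend_colouring[of "\<Union>F" F "{}" "\<lambda>_. Red"])
      show "finite (\<Union>F)" using Suc.prems by blast
      show "\<And>t. t \<in> F \<Longrightarrow> finite t \<and> 3 \<le> card t" by (rule Suc.prems(2))
      show "\<And>e r s t. e \<in> r \<Longrightarrow> e \<in> s \<Longrightarrow> e \<in> t \<Longrightarrow> r \<in> F \<Longrightarrow> s \<in> F \<Longrightarrow> t \<in> F \<Longrightarrow> r = s \<or> s = t \<or> r = t"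
        using False Suc.prems(3) by meson
    next
      assume "{} \<in> F"
      then show "1 \<le> card ({} \<inter> \<Union>F)" using Suc.prems(2)[of "{}"] by simp
    next
      fix t assume "t \<in> F"
      moreover from this have "t \<inter> \<Union>F = t" by blast
      ultimately show "2 \<le> card (t \<inter> \<Union>F)" using Suc.prems(2)[of t] by simp
    qed
  qed
qed

section \<open>Subgraphs and triangles\<close>

lemma adjacent_commute: "adjacent G u v \<longleftrightarrow> adjacent G v u"
  by (simp add: adjacent_def insert_commute)

lemma not_adjacent_self: "simple_graph G \<Longrightarrow> \<not> adjacent G v v"
  by (auto simp: simple_graph_def adjacent_def nsets_def)

lemma adjacent_verts: "simple_graph G \<Longrightarrow> adjacent G u v \<Longrightarrow> u \<in> verts G \<and> v \<in> verts G \<and> u \<noteq> v"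
  by (auto simp: simple_graph_def adjacent_def nsets_def)

lemma simple_graph_complete_graph: "simple_graph (complete_graph n)"
  by (simp add: simple_graph_def complete_graph_def)

lemma adjacent_complete_graph: "adjacent (complete_graph n) i j \<longleftrightarrow> i < n \<and> j < n \<and> i \<noteq> j"
  by (auto simp: complete_graph_def adjacent_def nsets_def card_2_iff doubleton_eq_iff)

text \<open>Since subgraphs need not be induced, an injective homomorphism suffices: its image is a
  copy of \<open>H\<close>, whatever further edges \<open>G\<close> has.\<close>

lemma contains_graphI:
  assumes H: "simple_graph H" and f: "inj_on f (verts H)" "f ` verts H \<subseteq> verts G"
    and adj: "\<And>u v. u \<in> verts H \<Longrightarrow> v \<in> verts H \<Longrightarrow> adjacent H u v \<Longrightarrow> adjacent G (f u) (f v)"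
  shows "contains_graph G H"
proof -
  have "contains_graph H H"
    unfolding contains_graph_def isomorphic_def subgraph_def
    using H by (intro exI[of _ H]) (auto intro!: exI[of _ id])
  then have "contains_graph (image_graph f H) H"
    using contains_graph_image_graph f(1) H by blast
  moreover have "edges (image_graph f H) \<subseteq> edges G"
  proof
    fix e assume "e \<in> edges (image_graph f H)"
    then obtain e' where e': "e' \<in> edges H" "e = f ` e'" by (auto simp: image_graph_def)
    then have "e' \<in> [verts H]\<^bsup>2\<^esup>" using H by (auto simp: simple_graph_def)
    then obtain u v where "e' = {u, v}" "u \<in> verts H" "v \<in> verts H"
      by (auto simp: nsets_def card_2_iff)
    then show "e \<in> edges G" using adj[of u v] e' by (simp add: adjacent_def)
  qed
  ultimately show ?thesis
    using f(2) unfolding contains_graph_def subgraph_def by (fastforce simp: image_graph_def)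
qed

lemma contains_triangleD:
  assumes "contains_graph G (complete_graph 3)"
  obtains x y z where "adjacent G x y" "adjacent G y z" "adjacent G x z"
proof -
  obtain F f where F: "edges F \<subseteq> edges G" and f: "bij_betw f (verts F) {..<3}"
    and adj: "\<And>u v. u \<in> verts F \<Longrightarrow> v \<in> verts F \<Longrightarrow>
      adjacent F u v \<longleftrightarrow> adjacent (complete_graph 3) (f u) (f v)"
    using assms unfolding contains_graph_def isomorphic_def subgraph_def
    by (auto simp: complete_graph_def)
  have "\<exists>x\<in>verts F. f x = i" if "i < 3" for i
    using f that by (metis bij_betw_imp_surj_on image_iff lessThan_iff)
  from this[of 0] this[of 1] this[of 2]
  obtain x y z where "x \<in> verts F" "y \<in> verts F" "z \<in> verts F" "f x = 0" "f y = 1" "f z = 2"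
    by auto
  then have "adjacent F x y" "adjacent F y z" "adjacent F x z"
    using adj by (simp_all add: adjacent_complete_graph)
  then show ?thesis using that F by (auto simp: adjacent_def)
qed

text \<open>Encoded by its three edges, because edges are the points of the hypergraph to be
  coloured.\<close>

definition triangle :: "'a \<Rightarrow> 'a \<Rightarrow> 'a \<Rightarrow> 'a set set" where
  "triangle x y z = {{x, y}, {y, z}, {x, z}}"

definition triangles :: "'a ugraph \<Rightarrow> 'a set set set" where
  "triangles G = {triangle x y z | x y z. adjacent G x y \<and> adjacent G y z \<and> adjacent G x z}"

lemma triangle_commute: "triangle y x z = triangle x y z" "triangle x z y = triangle x y z"
  by (auto simp: triangle_def insert_commute)

lemma card_triangle: "x \<noteq> y \<Longrightarrow> y \<noteq> z \<Longrightarrow> x \<noteq> z \<Longrightarrow> card (triangle x y z) = 3"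
  by (auto simp: triangle_def doubleton_eq_iff)

text \<open>A monochromatic \<open>K_3\<close> is a triangle whose edge set is constant, so one good
  colouring refutes the arrow relation.\<close>

lemma not_edge_arrowsI:
  assumes "\<And>t. t \<in> triangles G \<Longrightarrow> \<not> constant_on c t"
  shows "\<not> edge_arrows G (complete_graph 3) (complete_graph 3)"
proof
  assume "edge_arrows G (complete_graph 3) (complete_graph 3)"
  then obtain k where "contains_graph (colour_class G c k) (complete_graph 3)"
    unfolding edge_arrows_def by blast
  then obtain x y z where "adjacent (colour_class G c k) x y" "adjacent (colour_class G c k) y z"
      "adjacent (colour_class G c k) x z"
    by (rule contains_triangleD)
  then have "triangle x y z \<in> triangles G" "constant_on c (triangle x y z)"
    by (auto simp: triangles_def triangle_def constant_on_def colour_class_def adjacent_def)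
  then show False using assms by blast
qed

lemma triangles_through_edge:
  assumes "t \<in> triangles G" "{u, v} \<in> t" "simple_graph G"
  obtains w where "t = triangle u v w" "adjacent G u w" "adjacent G v w"
proof -
  obtain x y z where t: "t = triangle x y z" "adjacent G x y" "adjacent G y z" "adjacent G x z"
    using assms(1) by (auto simp: triangles_def)
  consider "{u, v} = {x, y}" | "{u, v} = {y, z}" | "{u, v} = {x, z}"
    using assms(2) t(1) by (auto simp: triangle_def)
  then show ?thesis
  proof cases
    case 1
    then show ?thesis
      using that[of z] t by (auto simp: doubleton_eq_iff triangle_commute adjacent_commute)
  next
    case 2
    then show ?thesis
      using that[of x] t by (auto simp: doubleton_eq_iff triangle_commute adjacent_commute)
  next
    case 3
    then show ?thesis
      using that[of y] t by (auto simp: doubleton_eq_iff triangle_commute adjacent_commute)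
  qed
qed

section \<open>Graphs on five vertices without a complete subgraph on four\<close>

lemma nonadjacent_if_free_of_K4:
  assumes H: "simple_graph H" "free_of H (complete_graph 4)"
    and v: "distinct [w, x, y, z]" "{w, x, y, z} \<subseteq> verts H"
  shows "\<not> adjacent H w x \<or> \<not> adjacent H w y \<or> \<not> adjacent H w z
    \<or> \<not> adjacent H x y \<or> \<not> adjacent H x z \<or> \<not> adjacent H y z"
proof (rule ccontr)
  assume *: "\<not> ?thesis"
  have 4: "{..<4} = {0, 1, 2, 3 :: nat}" by auto
  have "contains_graph H (complete_graph 4)"
  proof (rule contains_graphI[OF simple_graph_complete_graph])
    show "inj_on (\<lambda>i. [w, x, y, z] ! i) (verts (complete_graph 4))"
      using v(1) by (simp add: complete_graph_def inj_on_nth)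
    show "(\<lambda>i. [w, x, y, z] ! i) ` verts (complete_graph 4) \<subseteq> verts H"
      using v(2) by (simp add: complete_graph_def 4 numeral_2_eq_2 numeral_3_eq_3)
  next
    fix i j assume "adjacent (complete_graph 4) i j"
    then have "i \<in> {..<4}" "j \<in> {..<4}" "i \<noteq> j" by (auto simp: adjacent_complete_graph)
    then show "adjacent H ([w, x, y, z] ! i) ([w, x, y, z] ! j)"
      using * adjacent_commute[of H] unfolding 4
      by (elim insertE emptyE) (simp_all add: numeral_2_eq_2 numeral_3_eq_3)
  qed
  then show False using H(2) by simp
qed

lemma isomorphic_wheel:
  assumes "simple_graph H" "verts H = {x, y, p, q, r}" "distinct [x, y, p, q, r]"
    and "\<not> adjacent H x y" "\<not> adjacent H p q"
    and "adjacent H x p" "adjacent H x q" "adjacent H y p" "adjacent H y q"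
    and "adjacent H r x" "adjacent H r y" "adjacent H r p" "adjacent H r q"
  shows "isomorphic H (join_graph (complete_graph 1) (cycle_graph 4))"
proof -
  \<comment> \<open>\<open>x\<close>, \<open>p\<close>, \<open>y\<close>, \<open>q\<close> go round
    the 4-cycle, so the non-edges \<open>xy\<close> and \<open>pq\<close> are its diagonals;
    \<open>r\<close> takes the default value, the hub.\<close>
  define f :: "'a \<Rightarrow> nat + nat" where
    "f = (\<lambda>_. Inl 0)(x := Inr 0, p := Inr 1, y := Inr 2, q := Inr 3)"
  have f: "f r = Inl 0" "f x = Inr 0" "f p = Inr 1" "f y = Inr 2" "f q = Inr 3"
    using assms(3) by (auto simp: f_def)
  have C: "edges (cycle_graph 4) = {{0, 1}, {1, 2}, {2, 3}, {3, 0}}"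
  proof -
    have "edges (cycle_graph 4) = (\<lambda>i. {i, Suc i mod 4}) ` {..<4}" by (auto simp: cycle_graph_def)
    moreover have "{..<4} = {0, 1, 2, 3 :: nat}" by auto
    ultimately show ?thesis by (simp add: numeral_2_eq_2[symmetric])
  qed
  have V: "verts (join_graph (complete_graph 1) (cycle_graph 4)) = {Inl 0, Inr 0, Inr 1, Inr 2, Inr 3}"
    by (auto simp: join_graph_def complete_graph_def cycle_graph_def)
  have E: "edges (join_graph (complete_graph 1) (cycle_graph 4)) =
      {{Inr 0, Inr 1}, {Inr 1, Inr 2}, {Inr 2, Inr 3}, {Inr 3, Inr 0},
       {Inl 0, Inr 0}, {Inl 0, Inr 1}, {Inl 0, Inr 2}, {Inl 0, Inr 3}}"
  proof -
    have "edges (complete_graph 1) = {}" "verts (complete_graph 1) = {0}"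
      "verts (cycle_graph 4) = {0, 1, 2, 3}"
      by (auto simp: complete_graph_def cycle_graph_def nsets_def card_2_iff)
    then show ?thesis
      unfolding join_graph_def disjoint_union_def C by auto
  qed
  show ?thesis
    unfolding isomorphic_def
  proof (intro exI[of _ f] conjI)
    show "bij_betw f (verts H) (verts (join_graph (complete_graph 1) (cycle_graph 4)))"
      unfolding bij_betw_def V assms(2) by (auto simp: inj_on_def f)
    show "\<forall>u\<in>verts H. \<forall>v\<in>verts H.
        adjacent H u v \<longleftrightarrow> adjacent (join_graph (complete_graph 1) (cycle_graph 4)) (f u) (f v)"
      using assms(4-) adjacent_commute[of H] not_adjacent_self[OF assms(1)]
      unfolding assms(2) adjacent_def[of "join_graph _ _"] E
      by (simp add: f doubleton_eq_iff)
  qed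
qed

lemma isomorphic_complement_P2_P3:
  assumes "simple_graph H" "verts H = {x, y, p, q, r}" "distinct [x, y, p, q, r]"
    and "\<not> adjacent H x y" "\<not> adjacent H r x" "\<not> adjacent H p q"
    and "adjacent H x p" "adjacent H x q" "adjacent H y p" "adjacent H y q"
    and "adjacent H r y" "adjacent H r p" "adjacent H r q"
  shows "isomorphic H (complement_graph (disjoint_union (path_graph 2) (path_graph 3)))"
proof -
  \<comment> \<open>In the complement \<open>pq\<close> is the \<open>P_2\<close> and
    \<open>r\<close>, \<open>x\<close>, \<open>y\<close> in this order form the \<open>P_3\<close>;
    \<open>p\<close> takes the default value.\<close>
  define f :: "'a \<Rightarrow> nat + nat" where
    "f = (\<lambda>_. Inl 0)(q := Inl 1, r := Inr 0, x := Inr 1, y := Inr 2)"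
  have f: "f p = Inl 0" "f q = Inl 1" "f r = Inr 0" "f x = Inr 1" "f y = Inr 2"
    using assms(3) by (auto simp: f_def)
  let ?D = "disjoint_union (path_graph 2) (path_graph 3)"
  have V: "verts ?D = {Inl 0, Inl 1, Inr 0, Inr 1, Inr 2}"
    by (auto simp: disjoint_union_def path_graph_def)
  have "edges (path_graph 2) = {{0, 1}}" "edges (path_graph 3) = {{0, 1}, {1, 2}}"
    unfolding path_graph_def by (auto simp: less_Suc_eq numeral_eq_Suc)
  then have E: "edges ?D = {{Inl 0, Inl 1}, {Inr 0, Inr 1}, {Inr 1, Inr 2}}"
    unfolding disjoint_union_def by auto
  have adj: "adjacent (complement_graph ?D) u v \<longleftrightarrow>
      u \<in> verts ?D \<and> v \<in> verts ?D \<and> u \<noteq> v \<and> {u, v} \<notin> edges ?D" for u v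
    by (auto simp: adjacent_def complement_graph_def nsets_def card_2_iff doubleton_eq_iff)
  show ?thesis
    unfolding isomorphic_def
  proof (intro exI[of _ f] conjI)
    have "verts (complement_graph ?D) = verts ?D" by (simp add: complement_graph_def)
    then show "bij_betw f (verts H) (verts (complement_graph ?D))"
      unfolding bij_betw_def V assms(2) by (auto simp: inj_on_def f)
    show "\<forall>u\<in>verts H. \<forall>v\<in>verts H. adjacent H u v \<longleftrightarrow> adjacent (complement_graph ?D) (f u) (f v)"
      using assms(4-) adjacent_commute[of H] not_adjacent_self[OF assms(1)]
      unfolding adj V E assms(2)
      by (simp add: f doubleton_eq_iff)
  qed
qed

text \<open>
  With \<open>V(H) = {a, b, c, d, e}\<close>, these say that \<open>H\<close> is a subgraph of the book
  \<open>K\<^sub>1\<^sub>,\<^sub>1\<^sub>,\<^sub>3\<close> with spine \<open>de\<close>, respectively of the gem \<open>K\<^sub>1 + P\<^sub>4\<close> with hub \<open>e\<close> and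
  path \<open>c a d b\<close>.
\<close>

definition sub_book :: "'a ugraph \<Rightarrow> bool" where
  "sub_book H \<longleftrightarrow> (\<exists>a b c d e. verts H = {a, b, c, d, e} \<and> distinct [a, b, c, d, e]
     \<and> \<not> adjacent H a b \<and> \<not> adjacent H b c \<and> \<not> adjacent H a c)"

definition sub_gem :: "'a ugraph \<Rightarrow> bool" where
  "sub_gem H \<longleftrightarrow> (\<exists>a b c d e. verts H = {a, b, c, d, e} \<and> distinct [a, b, c, d, e]
     \<and> \<not> adjacent H a b \<and> \<not> adjacent H b c \<and> \<not> adjacent H c d)"

lemma sub_bookI:
  "\<lbrakk>\<not> adjacent H a b; \<not> adjacent H b c; \<not> adjacent H a c; verts H = {a, b, c, d, e};
    distinct [a, b, c, d, e]\<rbrakk> \<Longrightarrow> sub_book H"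
  unfolding sub_book_def by blast

lemma sub_gemI:
  "\<lbrakk>\<not> adjacent H a b; \<not> adjacent H b c; \<not> adjacent H c d; verts H = {a, b, c, d, e};
    distinct [a, b, c, d, e]\<rbrakk> \<Longrightarrow> sub_gem H"
  unfolding sub_gem_def by blast

text \<open>In the complement, an edge between \<open>xy\<close> and \<open>pq\<close> gives a
  four-vertex path; edges at \<open>r\<close> lead to a triangle, a four-vertex path or
  \<open>P_2 \<union> P_3\<close>; no further edge at all leaves the wheel.\<close>

lemma two_disjoint_nonedges:
  assumes H: "simple_graph H" "verts H = {x, y, p, q, r}" "distinct [x, y, p, q, r]"
    and non: "\<not> adjacent H x y" "\<not> adjacent H p q"
    and niso: "\<not> isomorphic H (join_graph (complete_graph 1) (cycle_graph 4))"
      "\<not> isomorphic H (complement_graph (disjoint_union (path_graph 2) (path_graph 3)))"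
  shows "sub_book H \<or> sub_gem H"
proof (rule ccontr)
  assume *: "\<not> (sub_book H \<or> sub_gem H)"
  note comm = adjacent_commute[of H]
  have cross: "adjacent H u v" if "(u, u') \<in> {(x, y), (y, x)}" "(v, v') \<in> {(p, q), (q, p)}" for u u' v v'
  proof (rule ccontr)
    assume "\<not> adjacent H u v"
    moreover have "\<not> adjacent H u' u" "\<not> adjacent H v v'" using that non comm by auto
    moreover have "verts H = {u', u, v, v', r}" "distinct [u', u, v, v', r]" using that H(2,3) by auto
    ultimately show False using * sub_gemI[of H u' u v v' r] by blast
  qed
  have xp: "adjacent H x p" "adjacent H x q" "adjacent H y p" "adjacent H y q"
    using cross by blast+
  \<comment> \<open>Stated for any endpoint \<open>u\<close> of either non-edge, so that four
    symmetric instances give all edges at \<open>r\<close>.\<close>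
  have hub: "adjacent H r u"
    if n: "\<not> adjacent H u u'" "\<not> adjacent H v v'"
      and V: "verts H = {u, u', v, v', r}" "distinct [u, u', v, v', r]"
      and a: "adjacent H u v" "adjacent H u v'" "adjacent H u' v" "adjacent H u' v'" for u u' v v'
  proof (rule ccontr)
    assume ru: "\<not> adjacent H r u"
    have "adjacent H r u'"
    proof (rule ccontr)
      assume "\<not> adjacent H r u'"
      then show False using * sub_bookI[of H u u' r v v'] n ru V comm by (auto simp: insert_commute)
    qed
    moreover have "adjacent H r w" if "(w, w') \<in> {(v, v'), (v', v)}" for w w'
    proof (rule ccontr)
      assume "\<not> adjacent H r w"
      moreover have "verts H = {u', u, r, w, w'}" "distinct [u', u, r, w, w']" using that V by auto
      ultimately show False using * sub_gemI[of H u' u r w w'] n(1) ru comm by blast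
    qed
    ultimately show False
      using isomorphic_complement_P2_P3[of H u u' v v' r] H(1) V n ru a niso(2) by blast
  qed
  have "adjacent H r x" by (rule hub[of x y p q]) (use H non xp comm in auto)
  moreover have "adjacent H r y" by (rule hub[of y x p q]) (use H non xp comm in auto)
  moreover have "adjacent H r p" by (rule hub[of p q x y]) (use H non xp comm in auto)
  moreover have "adjacent H r q" by (rule hub[of q p x y]) (use H non xp comm in auto)
  ultimately show False
    using isomorphic_wheel[OF H non xp] niso(1) by blast
qed

text \<open>\<open>K_4\<close>-freeness gives a non-edge \<open>xy\<close>. Either some non-edge is
  disjoint from it, which is the previous lemma, or the other three vertices form a triangle; then
  \<open>x\<close> and \<open>y\<close> each miss at least one of them.\<close>

lemma sub_book_or_sub_gem:
  assumes H: "simple_graph H" "card (verts H) = 5" "free_of H (complete_graph 4)"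
    and niso: "\<not> isomorphic H (join_graph (complete_graph 1) (cycle_graph 4))"
      "\<not> isomorphic H (complement_graph (disjoint_union (path_graph 2) (path_graph 3)))"
  shows "sub_book H \<or> sub_gem H"
proof (rule ccontr)
  assume *: "\<not> (sub_book H \<or> sub_gem H)"
  note comm = adjacent_commute[of H]
  obtain x y p q r where V: "verts H = {x, y, p, q, r}" "distinct [x, y, p, q, r]"
    and xy: "\<not> adjacent H x y"
  proof -
    obtain vs where "distinct vs" "set vs = verts H"
      using H(1) finite_distinct_list unfolding simple_graph_def by metis
    moreover from this have "length vs = 5" using H(2) distinct_card by metis
    moreover from this obtain a b c d e where "vs = [a, b, c, d, e]"
      by (auto simp: length_Suc_conv numeral_eq_Suc)
    ultimately have V: "verts H = {a, b, c, d, e}" "distinct [a, b, c, d, e]"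
      by auto
    then have "\<not> adjacent H a b \<or> \<not> adjacent H a c \<or> \<not> adjacent H a d
      \<or> \<not> adjacent H b c \<or> \<not> adjacent H b d \<or> \<not> adjacent H c d"
      by (intro nonadjacent_if_free_of_K4[OF H(1,3)]) auto
    then show ?thesis
      using that[of a b c d e] that[of a c b d e] that[of a d b c e]
        that[of b c a d e] that[of b d a c e] that[of c d a b e] V
      by (elim disjE) (auto simp: insert_commute)
  qed
  have rest: "adjacent H u v"
    if "verts H = {x, y, u, v, w}" "distinct [x, y, u, v, w]" for u v w
    using two_disjoint_nonedges[OF H(1) that xy] niso * by blast
  have pqr: "adjacent H p q" "adjacent H p r" "adjacent H q r"
    by (rule rest[of p q r] rest[of p r q] rest[of q r p]; use V in auto)+
  have "\<not> adjacent H u p \<or> \<not> adjacent H u q \<or> \<not> adjacent H u r" if "u \<in> {x, y}" for u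
  proof -
    have "distinct [u, p, q, r]" "{u, p, q, r} \<subseteq> verts H" using V that by auto
    then show ?thesis using nonadjacent_if_free_of_K4[OF H(1,3)] pqr by blast
  qed
  from this[of x] this[of y] obtain s t
    where s: "s \<in> {p, q, r}" "\<not> adjacent H x s" and t: "t \<in> {p, q, r}" "\<not> adjacent H y t"
    by blast
  show False
  \<comment> \<open>In the complement, \<open>s = t\<close> closes a triangle \<open>x y s\<close>,
    while distinct \<open>s\<close> and \<open>t\<close> give the path
    \<open>s x y t\<close>.\<close>
  proof (cases "s = t")
    case True
    obtain v w where "verts H = {x, y, s, v, w}" "distinct [x, y, s, v, w]"
    proof -
      show ?thesis
        using s(1) V that[of q r] that[of p r] that[of p q]
        by (elim insertE emptyE) (auto simp: insert_commute)
    qed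
    then show False using sub_bookI[of H x y s v w] xy s(2) t(2) True * by blast
  next
    case False
    obtain w where "{p, q, r} = {s, t, w}" "distinct [s, t, w]"
    proof -
      show ?thesis
        using s(1) t(1) False V(2) that[of p] that[of q] that[of r]
        by (elim insertE emptyE) (auto simp: insert_commute)
    qed
    then have "verts H = {s, x, y, t, w}" "distinct [s, x, y, t, w]" using V by auto
    then show False using sub_gemI[of H s x y t w] s(2) t(2) xy comm * by blast
  qed
qed

section \<open>Triangles of book-free and gem-free graphs\<close>

lemma contains_if_sub_book:
  assumes "simple_graph H" "sub_book H" "simple_graph G"
    and "adjacent G u v" and w: "distinct [w1, w2, w3]"
    and "\<And>w. w \<in> {w1, w2, w3} \<Longrightarrow> adjacent G u w \<and> adjacent G v w"
  shows "contains_graph G H"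
proof -
  obtain a b c d e where V: "verts H = {a, b, c, d, e}" "distinct [a, b, c, d, e]"
    and n: "\<not> adjacent H a b" "\<not> adjacent H b c" "\<not> adjacent H a c"
    using assms(2) unfolding sub_book_def by blast
  \<comment> \<open>The pairwise nonadjacent vertices become the pages \<open>w1\<close>,
    \<open>w2\<close>, \<open>w3\<close>; \<open>d\<close> and \<open>e\<close> become the spine,
    \<open>e\<close> by default.\<close>
  define f where "f = (\<lambda>_. u)(a := w1, b := w2, c := w3, d := v)"
  have f: "f a = w1" "f b = w2" "f c = w3" "f d = v" "f e = u" using V(2) by (auto simp: f_def)
  have adj: "adjacent G u v" "adjacent G u w1" "adjacent G u w2" "adjacent G u w3"
    "adjacent G v w1" "adjacent G v w2" "adjacent G v w3" using assms(4,6) by auto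
  note ne = adj[THEN adjacent_verts[OF assms(3)]]
  show ?thesis
  proof (rule contains_graphI[OF assms(1)])
    show "inj_on f (verts H)" using V(2) w ne by (auto simp: V(1) inj_on_def f)
    show "f ` verts H \<subseteq> verts G" using ne by (auto simp: V(1) f)
  next
    fix x y assume "x \<in> verts H" "y \<in> verts H" "adjacent H x y"
    then show "adjacent G (f x) (f y)"
      using n adj adjacent_commute[of G] adjacent_commute[of H] not_adjacent_self[OF assms(1)]
      unfolding V(1) by (elim insertE emptyE) (auto simp: f)
  qed
qed

lemma contains_if_sub_gem:
  assumes "simple_graph H" "sub_gem H" "simple_graph G"
    and p: "distinct [p1, p2, p3, p4]"
    and adj: "adjacent G p1 p2" "adjacent G p2 p3" "adjacent G p3 p4"
      "adjacent G h p1" "adjacent G h p2" "adjacent G h p3" "adjacent G h p4"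
  shows "contains_graph G H"
proof -
  obtain a b c d e where V: "verts H = {a, b, c, d, e}" "distinct [a, b, c, d, e]"
    and n: "\<not> adjacent H a b" "\<not> adjacent H b c" "\<not> adjacent H c d"
    using assms(2) unfolding sub_gem_def by blast
  \<comment> \<open>The complement of the path \<open>a b c d\<close> is the path
    \<open>c a d b\<close>, which is laid along \<open>p1 p2 p3 p4\<close>; \<open>e\<close> takes
    the default value, the hub.\<close>
  define f where "f = (\<lambda>_. h)(a := p2, b := p4, c := p1, d := p3)"
  have f: "f a = p2" "f b = p4" "f c = p1" "f d = p3" "f e = h" using V(2) by (auto simp: f_def)
  note ne = adj[THEN adjacent_verts[OF assms(3)]]
  show ?thesis
  proof (rule contains_graphI[OF assms(1)])
    show "inj_on f (verts H)" using V(2) p ne by (auto simp: V(1) inj_on_def f)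
    show "f ` verts H \<subseteq> verts G" using ne by (auto simp: V(1) f)
  next
    fix x y assume "x \<in> verts H" "y \<in> verts H" "adjacent H x y"
    then show "adjacent G (f x) (f y)"
      using n adj adjacent_commute[of G] adjacent_commute[of H] not_adjacent_self[OF assms(1)]
      unfolding V(1) by (elim insertE emptyE) (auto simp: f)
  qed
qed

text \<open>Three distinct triangles over one edge have distinct apexes and so form a book with that
  edge as spine.\<close>

lemma triangles_sub_book_free:
  assumes H: "simple_graph H" "sub_book H" and G: "simple_graph G" "free_of G H"
    and "e \<in> r" "e \<in> s" "e \<in> t" and "r \<in> triangles G" "s \<in> triangles G" "t \<in> triangles G"
  shows "r = s \<or> s = t \<or> r = t"
proof (rule ccontr)
  assume ne: "\<not> ?thesis"
  obtain u v where e: "e = {u, v}" "adjacent G u v"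
    using assms(5,8) by (auto simp: triangles_def triangle_def)
  obtain w1 where w1: "r = triangle u v w1" "adjacent G u w1" "adjacent G v w1"
    using triangles_through_edge[OF assms(8), of u v] assms(5) e(1) G(1) by blast
  obtain w2 where w2: "s = triangle u v w2" "adjacent G u w2" "adjacent G v w2"
    using triangles_through_edge[OF assms(9), of u v] assms(6) e(1) G(1) by blast
  obtain w3 where w3: "t = triangle u v w3" "adjacent G u w3" "adjacent G v w3"
    using triangles_through_edge[OF assms(10), of u v] assms(7) e(1) G(1) by blast
  have "distinct [w1, w2, w3]" using ne w1(1) w2(1) w3(1) by auto
  then have "contains_graph G H"
    using contains_if_sub_book[OF H G(1) e(2), of w1 w2 w3] w1 w2 w3 by blast
  then show False using G(2) by blast
qed

text \<open>
  If \<open>uw\<close> also lies in a triangle \<open>uwy\<close> and \<open>uv\<close> in a triangle \<open>uvx\<close>, where \<open>y \<noteq> v\<close>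
  and \<open>x \<noteq> w\<close>, then \<open>x v w y\<close> is a path in the neighbourhood of \<open>u\<close>, unless \<open>x = y\<close>.
\<close>

lemma triangles_sub_gem_free:
  assumes H: "simple_graph H" "sub_gem H" and G: "simple_graph G" "free_of G H"
    and t: "t \<in> triangles G" and not_private: "\<And>e. e \<in> t \<Longrightarrow> \<exists>s\<in>triangles G. e \<in> s \<and> s \<noteq> t"
    and "e \<in> r" "e \<in> s" "e \<in> t" and "r \<in> triangles G" "s \<in> triangles G"
  shows "r = s \<or> s = t \<or> r = t"
proof -
  obtain u v where e: "e = {u, v}" "adjacent G u v"
    using t assms(9) by (auto simp: triangles_def triangle_def)
  obtain w where w: "t = triangle u v w" "adjacent G u w" "adjacent G v w"
    using triangles_through_edge[OF t, of u v] assms(9) e(1) G(1) by blast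
  have "{u, w} \<in> t" using w(1) by (simp add: triangle_def)
  then obtain t' where t': "t' \<in> triangles G" "{u, w} \<in> t'" "t' \<noteq> t" using not_private by blast
  obtain y where y: "t' = triangle u w y" "adjacent G u y" "adjacent G w y"
    using triangles_through_edge[OF t'(1,2) G(1)] by blast
  have "y \<noteq> v" using t'(3) y(1) w(1) triangle_commute by metis
  \<comment> \<open>\<open>y\<close> is fixed before \<open>s\<close>, so all triangles over
    \<open>e\<close> other than \<open>t\<close> share one apex.\<close>
  have apex: "s = t \<or> s = triangle u v y" if s: "s \<in> triangles G" "e \<in> s" for s
  proof -
    obtain x where x: "s = triangle u v x" "adjacent G u x" "adjacent G v x"
      using triangles_through_edge[OF s(1), of u v] s(2) e(1) G(1) by blast
    have "x = w \<or> x = y"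
    proof (rule ccontr)
      assume "\<not> (x = w \<or> x = y)"
      moreover have "x \<noteq> v" "v \<noteq> w" "w \<noteq> y"
        using x(3) w(3) y(3) adjacent_verts[OF G(1)] by blast+
      ultimately have "distinct [x, v, w, y]" using \<open>y \<noteq> v\<close> by auto
      then have "contains_graph G H"
        using contains_if_sub_gem[OF H G(1), of x v w y u] x w y e(2) adjacent_commute[of G] by blast
      then show False using G(2) by blast
    qed
    then show ?thesis using x(1) w(1) by blast
  qed
  show ?thesis using apex[of r] apex[of s] assms(7,8,10,11) by blast
qed

lemma finite_triangles:
  assumes "simple_graph G"
  shows "finite (triangles G)"
proof (rule finite_subset)
  show "triangles G \<subseteq> Pow (Pow (verts G))"
    using adjacent_verts[OF assms] by (auto simp: triangles_def triangle_def)
  show "finite (Pow (Pow (verts G)))" using assms by (simp add: simple_graph_def)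
qed

theorem theorem9:
  fixes H :: "'a ugraph"
  assumes "simple_graph H"
    and "card (verts H) = 5"
    and "connected_graph H"
    and "free_of H (complete_graph 4)"
    and "contains_graph H (complete_graph 3)"
    and "\<not> isomorphic H (join_graph (complete_graph 1) (cycle_graph 4))"
    and "\<not> isomorphic H (complement_graph (disjoint_union (path_graph 2) (path_graph 3)))"
  shows "\<not> edge_folkman_exists (complete_graph 3) (complete_graph 3) H"
proof -
  \<comment> \<open>It suffices to refute hosts on \<open>nat\<close>, over which
    \<open>edge_folkman_orders\<close> ranges.\<close>
  have "\<not> edge_arrows G (complete_graph 3) (complete_graph 3)"
    if G: "simple_graph G" "free_of G H" for G :: "nat ugraph"
  proof -
    have "\<exists>c. \<forall>t\<in>triangles G. \<not> constant_on c t"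
    proof (rule two_colouring[OF finite_triangles[OF G(1)]])
      fix t assume "t \<in> triangles G"
      then obtain x y z where "t = triangle x y z" "x \<noteq> y" "y \<noteq> z" "x \<noteq> z"
        using adjacent_verts[OF G(1)] by (auto simp: triangles_def)
      then show "finite t \<and> 3 \<le> card t" using card_triangle[of x y z] by (simp add: triangle_def)
    next
      fix t assume t: "t \<in> triangles G"
      consider "sub_book H" | "sub_gem H"
        using sub_book_or_sub_gem assms by blast
      then show "(\<exists>e\<in>t. \<forall>s\<in>triangles G. e \<in> s \<longrightarrow> s = t) \<or>
        (\<forall>e\<in>t. \<forall>r\<in>triangles G. \<forall>s\<in>triangles G. e \<in> r \<longrightarrow> e \<in> s \<longrightarrow> r = s \<or> s = t \<or> r = t)"
      proof cases
        case 1
        then show ?thesis using triangles_sub_book_free[OF assms(1) _ G] t by blast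
      next
        case 2
        show ?thesis
        proof (cases "\<exists>e\<in>t. \<forall>s\<in>triangles G. e \<in> s \<longrightarrow> s = t")
          case False
          \<comment> \<open>No edge of \<open>t\<close> is private, which lets
            \<open>triangles_sub_gem_free\<close> find a second triangle on another edge of
            \<open>t\<close>.\<close>
          then have "\<exists>s\<in>triangles G. e \<in> s \<and> s \<noteq> t" if "e \<in> t" for e
            using that by blast
          from triangles_sub_gem_free[OF assms(1) 2 G t this] show ?thesis by blast
        qed simp
      qed
    qed
    then show ?thesis using not_edge_arrowsI by blast
  qed
  then show ?thesis
    unfolding edge_folkman_exists_def edge_folkman_orders_def by blast
qed

end
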